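(* Let $\mathbb{K}=\mathbb{R}$ or $\mathbb{C}$ and suppose that $\mathfrak{A},\mathfrak{B}\in GL_{l}(\mathbb{K})$ are such that $[\mathfrak{A},\mathfrak{B}]=\mathfrak{A}\mathfrak{B}-\mathfrak{B}\mathfrak{A}=0$. Then $$\mathfrak{Q}=(\mathfrak{A},\ \mathfrak{A}^{-1}(I+\mathfrak{B}),\ (I+\mathfrak{A})\mathfrak{B}^{-1},\ \mathfrak{B},\ \mathfrak{B}^{-1}(I+\mathfrak{A}+\mathfrak{B})\mathfrak{A}^{-1})$$ is a matrix frieze quiddity sequence of a two-sided matrix-valued frieze of period $5$.
   Context: Let $I$, $O$ be the $l\times l$ identity and zero matrices. A matrix-valued frieze of period $p$ (with $p-3$ non-trivial rows) is an array of $l\times l$ matrices $\mathfrak{M}_{i,j}$, $i,j\in\mathbb{Z}$ with $i-2\le j\le i+p-2$, which is $p$-periodic ($\mathfrak{M}_{i+p,j+p}=\mathfrak{M}_{i,j}$), with $\mathfrak{M}_{i,i-2}=O=\mathfrak{M}_{i,i+p-2}$, $\mathfrak{M}_{i,i-1}=I=\mathfrak{M}_{i,i+p-3}$, and with entries $\mathfrak{M}_{i,j}\in GL_{l}(\mathbb{K})$ in the non-trivial rows $i\le j\le i+p-4$ (the row of index $d$ consists of the entries with $j-i=d$). It is a left matrix-valued frieze if $$\mathfrak{M}_{i,j}\mathfrak{M}_{i+1,j+1}-\mathfrak{M}_{i,j+1}\mathfrak{M}_{i+1,j}=I$$ for all $i,j$ with $i-1\le j\le i+p-3$, a right matrix-valued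 frieze if $$\mathfrak{M}_{i+1,j+1}\mathfrak{M}_{i,j}-\mathfrak{M}_{i+1,j}\mathfrak{M}_{i,j+1}=I$$ for all such $i,j$, and two-sided if it is both left and right. Its matrix frieze quiddity sequence is $(\mathfrak{M}_{0,0},\mathfrak{M}_{1,1},\ldots,\mathfrak{M}_{p-1,p-1})$.
   Formalization: The entries of a frieze must be invertible, which can fail (e.g. A = -I); it is shown that Q is the quiddity sequence of a two-sided frieze iff I+A, I+B and I+A+B are invertible, and that in general all frieze conditions except invertibility of the entries can be met. *)

theory Defs
  imports "HOL-Analysis.Analysis"
begin

text \<open>
  Arrays are represented by total functions \<open>M\<close> on pairs of integers; only the values on the band
  \<open>i - 2 \<le> j \<le> i + p - 2\<close> are ever constrained. The conditions that involve no invertibility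
  are kept separate from the requirement that the entries of the non-trivial rows be invertible.
\<close>

definition frieze_array :: "nat \<Rightarrow> (int \<Rightarrow> int \<Rightarrow> 'k::field ^ 'l ^ 'l) \<Rightarrow> bool" where
  "frieze_array p M \<longleftrightarrow>
     3 \<le> p \<and>
     (\<forall>i j. i - 2 \<le> j \<and> j \<le> i + int p - 2 \<longrightarrow> M (i + int p) (j + int p) = M i j) \<and>
     (\<forall>i. M i (i - 2) = 0 \<and> M i (i + int p - 2) = 0) \<and>
     (\<forall>i. M i (i - 1) = mat 1 \<and> M i (i + int p - 3) = mat 1)"

definition left_frieze_rule :: "nat \<Rightarrow> (int \<Rightarrow> int \<Rightarrow> 'k::field ^ 'l ^ 'l) \<Rightarrow> bool" where
  "left_frieze_rule p M \<longleftrightarrow>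
     (\<forall>i j. i - 1 \<le> j \<and> j \<le> i + int p - 3 \<longrightarrow>
        M i j ** M (i + 1) (j + 1) - M i (j + 1) ** M (i + 1) j = mat 1)"

definition right_frieze_rule :: "nat \<Rightarrow> (int \<Rightarrow> int \<Rightarrow> 'k::field ^ 'l ^ 'l) \<Rightarrow> bool" where
  "right_frieze_rule p M \<longleftrightarrow>
     (\<forall>i j. i - 1 \<le> j \<and> j \<le> i + int p - 3 \<longrightarrow>
        M (i + 1) (j + 1) ** M i j - M (i + 1) j ** M i (j + 1) = mat 1)"

definition matrix_frieze :: "nat \<Rightarrow> (int \<Rightarrow> int \<Rightarrow> 'k::field ^ 'l ^ 'l) \<Rightarrow> bool" where
  "matrix_frieze p M \<longleftrightarrow>
     frieze_array p M \<and> (\<forall>i j. i \<le> j \<and> j \<le> i + int p - 4 \<longrightarrow> invertible (M i j))"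

definition left_matrix_frieze :: "nat \<Rightarrow> (int \<Rightarrow> int \<Rightarrow> 'k::field ^ 'l ^ 'l) \<Rightarrow> bool" where
  "left_matrix_frieze p M \<longleftrightarrow> matrix_frieze p M \<and> left_frieze_rule p M"

definition right_matrix_frieze :: "nat \<Rightarrow> (int \<Rightarrow> int \<Rightarrow> 'k::field ^ 'l ^ 'l) \<Rightarrow> bool" where
  "right_matrix_frieze p M \<longleftrightarrow> matrix_frieze p M \<and> right_frieze_rule p M"

definition two_sided_matrix_frieze :: "nat \<Rightarrow> (int \<Rightarrow> int \<Rightarrow> 'k::field ^ 'l ^ 'l) \<Rightarrow> bool" where
  "two_sided_matrix_frieze p M \<longleftrightarrow> left_matrix_frieze p M \<and> right_matrix_frieze p M"

definition quiddity :: "nat \<Rightarrow> (int \<Rightarrow> int \<Rightarrow> 'k::field ^ 'l ^ 'l) \<Rightarrow> ('k ^ 'l ^ 'l) list" where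
  "quiddity p M = map (\<lambda>i. M (int i) (int i)) [0..<p]"

text \<open>
  The quiddity sequence of period 5 attached to a pair of matrices. If \<open>A\<close> and \<open>B\<close> are invertible
  and commute, its entries need not all be invertible (for instance \<open>A = - mat 1\<close> makes the third
  one zero).
\<close>

definition pentagon_quiddity :: "'k::field ^ 'l ^ 'l \<Rightarrow> 'k ^ 'l ^ 'l \<Rightarrow> ('k ^ 'l ^ 'l) list" where
  "pentagon_quiddity A B =
     [A,
      matrix_inv A ** (mat 1 + B),
      (mat 1 + A) ** matrix_inv B,
      B,
      matrix_inv B ** (mat 1 + A + B) ** matrix_inv A]"

end

theory Submission
  imports Defs
begin

text \<open>
  The frieze of period 5 is Gauss' pentagramma mirificum: the second non-trivial row is the first one
  shifted by three places, so that both rules reduce to \<open>a\<^sub>i a\<^sub>i\<^sub>+\<^sub>1 = I + a\<^sub>i\<^sub>+\<^sub>3\<close> for a sequence of period 5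
  with commuting neighbours. All entries of the given sequence lie in the commutative algebra generated by
  \<open>A\<close>, \<open>B\<close> and their inverses, where this relation is a computation. Finally, every entry of the sequence
  is a unit times one of \<open>A\<close>, \<open>B\<close>, \<open>I + A\<close>, \<open>I + B\<close>, \<open>I + A + B\<close>.
\<close>

text \<open>The default 0 fills the zero rows \<open>j = i - 2\<close> and \<open>j = i + 3\<close>;
  beyond the band the value is arbitrary.\<close>

definition pentagon_array :: "(int \<Rightarrow> 'k::field ^ 'l ^ 'l) \<Rightarrow> int \<Rightarrow> int \<Rightarrow> 'k ^ 'l ^ 'l" where
  "pentagon_array a i j =
     (if j = i then a i
      else if j = i + 1 then a (i + 3)
      else if j = i - 1 \<or> j = i + 2 then mat 1
      else 0)"

lemma frieze_array_pentagon_array: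
  assumes "\<And>i. a (i + 5) = a i"
  shows "frieze_array 5 (pentagon_array a)"
proof -
  have "a (i + 8) = a (i + 3)" for i
    using assms[of "i + 3"] by (simp add: add.assoc)
  with assms show ?thesis
    by (auto simp: frieze_array_def pentagon_array_def algebra_simps)
qed

lemma pentagon_band:
  fixes i j :: int
  assumes "i - 1 \<le> j \<and> j \<le> i + int 5 - 3"
  shows "j = i - 1 \<or> j = i \<or> j = i + 1 \<or> j = i + 2"
  using assms by auto

text \<open>For \<open>j = i - 1\<close> and \<open>j = i + 2\<close> the first product is I and the
  second has a zero factor. The case \<open>j = i\<close> is \<open>rel\<close> at \<open>i\<close>;
  the case \<open>j = i + 1\<close> is \<open>rel\<close> at \<open>i + 3\<close>, where the period
  turns \<open>a (i + 6)\<close> into \<open>a (i + 1)\<close>.\<close>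

lemma left_frieze_rule_pentagon_array:
  assumes per: "\<And>i. a (i + 5) = a i"
    and rel: "\<And>i. a i ** a (i + 1) = mat 1 + a (i + 3)"
  shows "left_frieze_rule 5 (pentagon_array a)"
proof -
  have "a (i + 3) ** a (i + 4) = mat 1 + a (i + 1)" for i
    using rel[of "i + 3"] per[of "i + 1"] by (simp add: add.assoc)
  then show ?thesis
    using rel unfolding left_frieze_rule_def
    by (auto dest!: pentagon_band simp: pentagon_array_def add.assoc)
qed

lemma right_frieze_rule_pentagon_array:
  assumes per: "\<And>i. a (i + 5) = a i"
    and rel: "\<And>i. a (i + 1) ** a i = mat 1 + a (i + 3)"
  shows "right_frieze_rule 5 (pentagon_array a)"
proof -
  have "a (i + 4) ** a (i + 3) = mat 1 + a (i + 1)" for i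
    using rel[of "i + 3"] per[of "i + 1"] by (simp add: add.assoc)
  then show ?thesis
    using rel unfolding right_frieze_rule_def
    by (auto dest!: pentagon_band simp: pentagon_array_def add.assoc)
qed

definition pentagon_seq :: "'k::field ^ 'l ^ 'l \<Rightarrow> 'k ^ 'l ^ 'l \<Rightarrow> int \<Rightarrow> 'k ^ 'l ^ 'l" where
  "pentagon_seq A B i = pentagon_quiddity A B ! nat (i mod 5)"

lemma pentagon_seq_periodic: "pentagon_seq A B (i + 5) = pentagon_seq A B i"
  by (simp add: pentagon_seq_def)

lemma quiddity_pentagon_array:
  "quiddity 5 (pentagon_array (pentagon_seq A B)) = pentagon_quiddity A B"
  by (simp add: quiddity_def pentagon_array_def pentagon_seq_def pentagon_quiddity_def upt_rec)

text \<open>Fixes the residues of all three indices of the pentagon relation at once, so that its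
  list entries can be evaluated.\<close>

lemma mod5_cases:
  fixes i :: int
  obtains "i mod 5 = 0" "(i + 1) mod 5 = 1" "(i + 3) mod 5 = 3"
  | "i mod 5 = 1" "(i + 1) mod 5 = 2" "(i + 3) mod 5 = 4"
  | "i mod 5 = 2" "(i + 1) mod 5 = 3" "(i + 3) mod 5 = 0"
  | "i mod 5 = 3" "(i + 1) mod 5 = 4" "(i + 3) mod 5 = 1"
  | "i mod 5 = 4" "(i + 1) mod 5 = 0" "(i + 3) mod 5 = 2"
proof -
  have shift: "(i + k) mod 5 = (r + k) mod 5" if "i mod 5 = r" for k r
    using that by (auto simp: mod_add_left_eq)
  have "i mod 5 = 0 \<or> i mod 5 = 1 \<or> i mod 5 = 2 \<or> i mod 5 = 3 \<or> i mod 5 = 4"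
    by presburger
  then show thesis
    by (elim disjE) (rule that; simp add: shift)+
qed

lemma matrix_add_rdistrib:
  fixes A B :: "'a::semiring_1 ^ 'n ^ 'm"
  shows "(A + B) ** C = A ** C + B ** C"
  by (simp add: matrix_matrix_mult_def vec_eq_iff distrib_right sum.distrib)

lemma matrix_inv_cancel:
  fixes A :: "'k::field ^ 'l ^ 'l"
  assumes "invertible A"
  shows "A ** matrix_inv A = mat 1" and "matrix_inv A ** A = mat 1"
  using someI_ex[OF assms[unfolded invertible_def]] by (simp_all add: matrix_inv_def)

lemma invertible_matrix_inv_self:
  fixes A :: "'k::field ^ 'l ^ 'l"
  assumes "invertible A"
  shows "invertible (matrix_inv A)"
  using assms matrix_inv_cancel unfolding invertible_def by blast

lemma matrix_inv_commute:
  fixes A B :: "'k::field ^ 'l ^ 'l"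
  assumes "invertible A" and "B ** A = A ** B"
  shows "B ** matrix_inv A = matrix_inv A ** B"
proof -
  \<comment> \<open>Padding with \<open>matrix_inv A ** A\<close> exposes \<open>A ** B\<close>;
    swapping these factors lets \<open>A\<close> meet its inverse on the right.\<close>
  have "B ** matrix_inv A = matrix_inv A ** (A ** B) ** matrix_inv A"
    using matrix_inv_cancel[OF assms(1)] by (simp add: matrix_mul_assoc)
  also have "\<dots> = matrix_inv A ** B ** (A ** matrix_inv A)"
    unfolding assms(2)[symmetric] by (simp add: matrix_mul_assoc)
  finally show ?thesis
    using matrix_inv_cancel[OF assms(1)] by simp
qed

lemma pentagon_seq_relations:
  fixes A B :: "'k::field ^ 'l ^ 'l"
  assumes A: "invertible A" and B: "invertible B" and AB: "A ** B = B ** A"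
  shows "pentagon_seq A B i ** pentagon_seq A B (i + 1) = mat 1 + pentagon_seq A B (i + 3)"
    and "pentagon_seq A B (i + 1) ** pentagon_seq A B i = mat 1 + pentagon_seq A B (i + 3)"
proof -
  define P Q where "P = matrix_inv A" and "Q = matrix_inv B"
  have inv: "A ** P = mat 1" "P ** A = mat 1" "B ** Q = mat 1" "Q ** B = mat 1"
    using matrix_inv_cancel A B by (auto simp: P_def Q_def)
  \<comment> \<open>Oriented to move \<open>A\<close>, \<open>P\<close> to the left of
    \<open>B\<close>, \<open>Q\<close>, which brings mutually inverse factors together.\<close>
  have comm: "B ** A = A ** B" "B ** P = P ** B" "Q ** A = A ** Q" "Q ** P = P ** Q"
    unfolding P_def Q_def by (metis AB A B matrix_inv_commute)+
  \<comment> \<open>Lets a rule for a product of two factors act inside a right-nested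
    product.\<close>
  have left: "X ** (Y ** Z) = W ** Z" if "X ** Y = W" for X Y Z W :: "'k ^ 'l ^ 'l"
    using that by (simp add: matrix_mul_assoc)
  have reassoc: "X ** Y ** Z = X ** (Y ** Z)" for X Y Z :: "'k ^ 'l ^ 'l"
    by (simp add: matrix_mul_assoc)
  note comm_left = comm[THEN left, unfolded reassoc]
  note arith = inv inv[THEN left] comm comm_left reassoc
    matrix_add_ldistrib matrix_add_rdistrib add_ac
  show "pentagon_seq A B i ** pentagon_seq A B (i + 1) = mat 1 + pentagon_seq A B (i + 3)"
    by (rule mod5_cases[of i])
      (simp_all add: pentagon_seq_def pentagon_quiddity_def flip: P_def Q_def, simp_all add: arith)
  show "pentagon_seq A B (i + 1) ** pentagon_seq A B i = mat 1 + pentagon_seq A B (i + 3)"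
    by (rule mod5_cases[of i])
      (simp_all add: pentagon_seq_def pentagon_quiddity_def flip: P_def Q_def, simp_all add: arith)
qed

text \<open>Over a field invertibility means nonzero determinant, and \<open>det\<close> is
  multiplicative.\<close>

lemma invertible_mult_left_iff:
  fixes A B :: "'k::field ^ 'l ^ 'l"
  assumes "invertible A"
  shows "invertible (A ** B) \<longleftrightarrow> invertible B"
  using assms by (simp add: invertible_det_nz det_mul)

lemma invertible_mult_right_iff:
  fixes A B :: "'k::field ^ 'l ^ 'l"
  assumes "invertible B"
  shows "invertible (A ** B) \<longleftrightarrow> invertible A"
  using assms by (simp add: invertible_det_nz det_mul)

lemma invertible_pentagon_quiddity_iff:
  fixes A B :: "'k::field ^ 'l ^ 'l"
  assumes "invertible A" and "invertible B"
  shows "(\<forall>X\<in>set (pentagon_quiddity A B). invertible X) \<longleftrightarrow>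
    invertible (mat 1 + A) \<and> invertible (mat 1 + B) \<and> invertible (mat 1 + A + B)"
  using assms
  by (auto simp: pentagon_quiddity_def invertible_matrix_inv_self
      invertible_mult_left_iff invertible_mult_right_iff)

lemma matrix_frieze_pentagon_array:
  assumes "\<And>i. a (i + 5) = a i" and "\<And>i. invertible (a i)"
  shows "matrix_frieze 5 (pentagon_array a)"
proof -
  \<comment> \<open>The two non-trivial rows both consist of values of \<open>a\<close>.\<close>
  have "j = i \<or> j = i + 1" if "i \<le> j" "j \<le> i + int 5 - 4" for i j :: int
    using that by auto
  then show ?thesis
    using assms frieze_array_pentagon_array[of a]
    by (fastforce simp: matrix_frieze_def pentagon_array_def)
qed

text \<open>The bound \<open>4 \<le> p\<close> makes the diagonal a non-trivial row.\<close>

lemma invertible_quiddity: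
  assumes "matrix_frieze p M" and "4 \<le> p" and "X \<in> set (quiddity p M)"
  shows "invertible X"
  using assms by (auto simp: matrix_frieze_def quiddity_def)

text \<open>Commuting invertible \<open>A\<close> and \<open>B\<close> may still give singular
  entries, so the rules are asserted first and the exact condition for invertible entries
  separately.\<close>

theorem theorem43:
  fixes A B :: "'k::{real_normed_field,banach} ^ 'l ^ 'l"
  assumes "invertible A" and "invertible B"
    and "A ** B - B ** A = 0"
  shows "(\<exists>M. frieze_array 5 M \<and> left_frieze_rule 5 M \<and> right_frieze_rule 5 M \<and>
              quiddity 5 M = pentagon_quiddity A B) \<and>
         ((\<exists>M. two_sided_matrix_frieze 5 M \<and> quiddity 5 M = pentagon_quiddity A B) \<longleftrightarrow>
            invertible (mat 1 + A) \<and> invertible (mat 1 + B) \<and> invertible (mat 1 + A + B))"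
    (is "?array \<and> (?frieze \<longleftrightarrow> ?inv)")
proof -
  let ?M = "pentagon_array (pentagon_seq A B)"
  have AB: "A ** B = B ** A"
    using assms(3) by simp
  note rel = pentagon_seq_relations[OF assms(1,2) AB]
  have rules: "left_frieze_rule 5 ?M" "right_frieze_rule 5 ?M"
    using left_frieze_rule_pentagon_array right_frieze_rule_pentagon_array
      pentagon_seq_periodic rel by blast+
  have ?array
    using frieze_array_pentagon_array pentagon_seq_periodic rules quiddity_pentagon_array by blast
  \<comment> \<open>The frieze is arbitrary here, but its diagonal must list the given
    sequence.\<close>
  moreover have ?inv if ?frieze
  proof -
    from that obtain M where "matrix_frieze 5 M" "quiddity 5 M = pentagon_quiddity A B"
      by (auto simp: two_sided_matrix_frieze_def left_matrix_frieze_def)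
    then have "\<forall>X\<in>set (pentagon_quiddity A B). invertible X"
      using invertible_quiddity[of 5 M] by auto
    then show ?thesis
      using invertible_pentagon_quiddity_iff[OF assms(1,2)] by blast
  qed
  moreover have ?frieze if ?inv
  proof -
    have "pentagon_seq A B i \<in> set (pentagon_quiddity A B)" for i
      unfolding pentagon_seq_def by (rule nth_mem) (simp add: pentagon_quiddity_def nat_less_iff)
    then have "matrix_frieze 5 ?M"
      using that invertible_pentagon_quiddity_iff[OF assms(1,2)] pentagon_seq_periodic
      by (blast intro: matrix_frieze_pentagon_array)
    then show ?thesis
      using rules quiddity_pentagon_array
      unfolding two_sided_matrix_frieze_def left_matrix_frieze_def right_matrix_frieze_def by blast
  qed
  ultimately show ?thesis by blast
qed

end
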